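(* Let $\gamma\in\mathbb R$. Let $x(n+1)=L(n)x_n+f(n)$, $n\ge0$, be a system of difference equations with bounded delay of order $d$. Then the following statements are equivalent: (i) The homogeneous system $x(n+1)=L(n)x_n$, $n\ge0$, is uniformly stable in $\mathcal X$ with respect to $\mathcal B^\gamma$ (or, equivalently, when $d\ge1$, with respect to $\mathcal B^\gamma_{[-d+1,0]}$). (ii) The nonhomogeneous system is $(\ell^1,\ell^\infty)$-stable.
   Context: $\mathbb Z^+$ and $\mathbb Z^-$ are the sets of nonnegative and nonpositive integers. $(\mathcal X,|\cdot|)$ is a (real or complex) Banach space. $\mathcal X^{\mathbb Z^-}$ is the vector space of all tuples $\varphi=(\varphi^{[m]})_{m\le 0}$ with $\varphi^{[m]}\in\mathcal X$; its zero vector is $0_{\mathcal B}$. For $\gamma\in\mathbb R$, $\mathcal B^\gamma=\{\varphi\in\mathcal X^{\mathbb Z^-}: |\varphi|_{\mathcal B^\gamma}:=\sup_{m\le 0}|\varphi^{[m]}|e^{\gamma m}<\infty\}$. For $j\in\mathbb Z^-$, $\mathcal B^\gamma_{[j,0]}$ is the vector space $\mathcal X^{\mathbb Z^-}$ with the seminorm $|\varphi|_{\mathcal B^\gamma_{[j,0]}}=\sup_{j\le m\le0}|\varphi^{[m]}|e^{\gamma m}$. For $1\le p\le\infty$, $\ell^p(\mathcal X)$ is the usual space of $p$-summable (bounded if $p=\infty$) functions $\mathbb Z^+\to\mathcal X$. For $x:\mathbb Z\to\mathcal X$ and $n\in\mathbb Z$, the prehistory $x_n\in\mathcal X^{\mathbb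 Z^-}$ is defined by $x_n^{[m]}=x(n+m)$, $m\le 0$. System with bounded delay: for $k\in\mathbb Z^+$ let $L(n,k):\mathcal X\to\mathcal X$ be $L(n,k)\psi=L(n)E_{-k}\psi$, where $E_{-k}\psi$ has $(-k)$-th coordinate $\psi$ and all other coordinates zero; it is required that all $L(n,k)$ are bounded linear operators on $\mathcal X$ and that there is $m\in\mathbb Z^-$ with $L(n)P_{[-\infty,m]}=0$ for all $n\in\mathbb Z^+$, where $P_{[-\infty,m]}$ keeps the coordinates with index $\le m$ and replaces the others by zero. If $m$ is the largest nonpositive integer with this property, the order is $d=|m|$. Such a system has the form $x(n+1)=\sum_{k=0}^{d-1}L(n,k)x(n-k)+f(n)$, $n\in\mathbb Z^+$ (empty sums are zero), and is considered on all of $\mathcal X^{\mathbb Z^-}$, i.e. $L(n)\varphi=\sum_{k=0}^{d-1}L(n,k)\varphi^{[-k]}$; any of the spaces $\mathcal B^\gamma$ or $\mathcal B^\gamma_{[j,0]}$ with $j\le -d+1$, $j\in\mathbb Z^-$, can be taken as phase space. For $\tau\in\mathbb Z^+$, $\varphi\in\mathcal X^{\mathbb Z^-}$ and $f:\mathbb Z^+\to\mathcal X$, $x(\cdot,\tau,\varphi;f):\mathbb Z\to\mathcal X$ is the unique function $x$ with $x_\tau=\varphi$ and $x(n+1)=L(n)x_n+f(n)$ for all $n\ge\tau$; $\mathbf 0$ is the zero function $f$. The nonhomogeneous system is $(\ell^1,\ell^\infty)$-stable if $x(\cdot,0,0_{\mathcal B};f)$ (restricted to $\mathbb Z^+$)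 belongs to $\ell^\infty(\mathcal X)$ for every $f\in\ell^1(\mathcal X)$. For a seminormed phase space $\mathcal B$, the homogeneous system is uniformly stable in $\mathcal X$ with respect to $\mathcal B$ if there exists $K\ge1$ such that $|x(n,\tau,\varphi;\mathbf 0)|\le K|\varphi|_{\mathcal B}$ for all $n\ge\tau\ge0$ and all $\varphi\in\mathcal B$. *)

theory Defs
  imports "HOL-Analysis.Analysis"
begin

text \<open>
  A tuple in \<open>X\<close> indexed by the nonpositive integers is encoded as a function \<open>\<phi> :: nat \<Rightarrow> 'a\<close>,
  where \<open>\<phi> k\<close> is the coordinate of index \<open>-k\<close>. Accordingly nonpositive integers occurring as
  parameters are given by their absolute values, and the weight \<open>exp (\<gamma> * m)\<close> at \<open>m = -k\<close>
  becomes \<open>exp (- \<gamma> * k)\<close>.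

  The space \<open>X\<close> is a real Banach space. The complex case is contained in it by restriction of
  scalars: none of the notions below other than the linearity of the coefficient operators
  refers to scalars, and complex linear operators are real linear.
\<close>

type_synonym 'a hist = "nat \<Rightarrow> 'a"

definition B_space :: "real \<Rightarrow> ('a::real_normed_vector) hist set" where
  "B_space \<gamma> = {\<phi>. bdd_above (range (\<lambda>k. norm (\<phi> k) * exp (- \<gamma> * real k)))}"

definition B_norm :: "real \<Rightarrow> ('a::real_normed_vector) hist \<Rightarrow> real" where
  "B_norm \<gamma> \<phi> = (SUP k. norm (\<phi> k) * exp (- \<gamma> * real k))"

text \<open>The seminorm of the phase space with window \<open>[-J, 0]\<close>, whose carrier is \<open>UNIV\<close>.\<close>

definition B_window_norm :: "real \<Rightarrow> nat \<Rightarrow> ('a::real_normed_vector) hist \<Rightarrow> real" where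
  "B_window_norm \<gamma> J \<phi> = (SUP k\<in>{0..J}. norm (\<phi> k) * exp (- \<gamma> * real k))"

definition ell_1 :: "(nat \<Rightarrow> 'a::real_normed_vector) set" where
  "ell_1 = {f. summable (\<lambda>n. norm (f n))}"

definition ell_infinity :: "(nat \<Rightarrow> 'a::real_normed_vector) set" where
  "ell_infinity = {f. bounded (range f)}"

definition prehistory :: "(int \<Rightarrow> 'a) \<Rightarrow> int \<Rightarrow> 'a hist" where
  "prehistory x n = (\<lambda>k. x (n - int k))"

text \<open>\<open>E_coord k \<psi>\<close> has \<open>(-k)\<close>-th coordinate \<open>\<psi>\<close>; \<open>P_past j\<close> keeps the coordinates of index at
  most \<open>-j\<close>.\<close>

definition E_coord :: "nat \<Rightarrow> 'a::zero \<Rightarrow> 'a hist" where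
  "E_coord k \<psi> = (\<lambda>i. if i = k then \<psi> else 0)"

definition P_past :: "nat \<Rightarrow> ('a::zero) hist \<Rightarrow> 'a hist" where
  "P_past j \<phi> = (\<lambda>i. if j \<le> i then \<phi> i else 0)"

definition coef :: "(nat \<Rightarrow> ('a::zero) hist \<Rightarrow> 'a) \<Rightarrow> nat \<Rightarrow> nat \<Rightarrow> 'a \<Rightarrow> 'a" where
  "coef L n k \<psi> = L n (E_coord k \<psi>)"

text \<open>The largest nonpositive \<open>m\<close> such that every \<open>L n\<close> vanishes on tuples supported on indices
  at most \<open>m\<close> corresponds to the least \<open>j = \<bar>m\<bar>\<close>. This is meaningful only if such a \<open>j\<close> exists,
  which is part of \<open>bounded_delay\<close>.\<close>

definition delay_order :: "(nat \<Rightarrow> ('a::zero) hist \<Rightarrow> 'a) \<Rightarrow> nat" where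
  "delay_order L = (LEAST j. \<forall>n \<phi>. L n (P_past j \<phi>) = 0)"

definition bounded_delay :: "(nat \<Rightarrow> ('a::real_normed_vector) hist \<Rightarrow> 'a) \<Rightarrow> bool" where
  "bounded_delay L \<longleftrightarrow>
     (\<forall>n k. bounded_linear (coef L n k)) \<and>
     (\<exists>j. \<forall>n \<phi>. L n (P_past j \<phi>) = 0) \<and>
     (\<forall>n \<phi>. L n \<phi> = (\<Sum>k<delay_order L. coef L n k (\<phi> k)))"

definition is_solution ::
  "(nat \<Rightarrow> ('a::plus) hist \<Rightarrow> 'a) \<Rightarrow> nat \<Rightarrow> 'a hist \<Rightarrow> (nat \<Rightarrow> 'a) \<Rightarrow> (int \<Rightarrow> 'a) \<Rightarrow> bool" where
  "is_solution L \<tau> \<phi> f x \<longleftrightarrow>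
     prehistory x (int \<tau>) = \<phi> \<and>
     (\<forall>n\<ge>\<tau>. x (int n + 1) = L n (prehistory x (int n)) + f n)"

definition solution ::
  "(nat \<Rightarrow> ('a::plus) hist \<Rightarrow> 'a) \<Rightarrow> nat \<Rightarrow> 'a hist \<Rightarrow> (nat \<Rightarrow> 'a) \<Rightarrow> int \<Rightarrow> 'a" where
  "solution L \<tau> \<phi> f = (THE x. is_solution L \<tau> \<phi> f x)"

primrec hist_iter ::
  "(nat \<Rightarrow> ('a::plus) hist \<Rightarrow> 'a) \<Rightarrow> nat \<Rightarrow> 'a hist \<Rightarrow> (nat \<Rightarrow> 'a) \<Rightarrow> nat \<Rightarrow> 'a hist" where
  "hist_iter L \<tau> \<phi> f 0 = \<phi>"
| "hist_iter L \<tau> \<phi> f (Suc i) =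
     case_nat (L (\<tau> + i) (hist_iter L \<tau> \<phi> f i) + f (\<tau> + i)) (hist_iter L \<tau> \<phi> f i)"

lemma prehistory_Suc: "prehistory x (n + 1) = case_nat (x (n + 1)) (prehistory x n)"
  by (rule ext) (simp add: prehistory_def split: nat.split)

lemma is_solution_prehistory:
  assumes "is_solution L \<tau> \<phi> f x"
  shows "prehistory x (int (\<tau> + i)) = hist_iter L \<tau> \<phi> f i"
proof (induction i)
  case 0
  then show ?case using assms by (simp add: is_solution_def)
next
  case (Suc i)
  have "prehistory x (int (\<tau> + i) + 1)
      = case_nat (x (int (\<tau> + i) + 1)) (prehistory x (int (\<tau> + i)))"
    by (rule prehistory_Suc)
  moreover have "x (int (\<tau> + i) + 1) = L (\<tau> + i) (prehistory x (int (\<tau> + i))) + f (\<tau> + i)"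
    using assms unfolding is_solution_def by (metis le_add1)
  moreover have "int (\<tau> + Suc i) = int (\<tau> + i) + 1" by simp
  ultimately show ?case using Suc by (simp add: add_ac)
qed

lemma hist_iter_shift:
  "hist_iter L \<tau> \<phi> f i k = (if k \<le> i then hist_iter L \<tau> \<phi> f (i - k) 0 else \<phi> (k - i))"
  by (induction i arbitrary: k) (auto split: nat.split)

lemma ex1_solution: "\<exists>!x. is_solution L \<tau> \<phi> f x"
proof
  define x where "x n = (if int \<tau> \<le> n then hist_iter L \<tau> \<phi> f (nat (n - int \<tau>)) 0
    else \<phi> (nat (int \<tau> - n)))" for n
  have pre: "prehistory x (int (\<tau> + i)) = hist_iter L \<tau> \<phi> f i" for i
  proof
    fix k
    show "prehistory x (int (\<tau> + i)) k = hist_iter L \<tau> \<phi> f i k"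
      by (subst hist_iter_shift) (auto simp: prehistory_def x_def nat_diff_distrib' 
          intro!: arg_cong[where f = \<phi>] arg_cong[where f = "\<lambda>j. hist_iter L \<tau> \<phi> f j 0"])
  qed
  have "x (int n + 1) = L n (prehistory x (int n)) + f n" if n: "\<tau> \<le> n" for n
  proof -
    obtain i where i: "n = \<tau> + i" using n le_Suc_ex by blast
    have "x (int n + 1) = prehistory x (int (\<tau> + Suc i)) 0"
      by (simp add: prehistory_def i add_ac)
    then show ?thesis using pre[of "Suc i"] pre[of i] i by simp
  qed
  then show "is_solution L \<tau> \<phi> f x"
    using pre[of 0] by (simp add: is_solution_def)
  fix y
  assume y: "is_solution L \<tau> \<phi> f y"
  show "y = x"
  proof
    fix n
    show "y n = x n"
    proof (cases "int \<tau> \<le> n")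
      case True
      then obtain i where "n = int (\<tau> + i)" by (metis of_nat_add zle_iff_zadd)
      then show ?thesis
        using fun_cong[OF is_solution_prehistory[OF y, of i], of 0] fun_cong[OF pre[of i], of 0]
        by (simp add: prehistory_def)
    next
      case False
      then have "n = int \<tau> - int (nat (int \<tau> - n))" by simp
      then show ?thesis
        using fun_cong[OF is_solution_prehistory[OF y, of 0], of "nat (int \<tau> - n)"]
          fun_cong[OF pre[of 0], of "nat (int \<tau> - n)"]
        by (simp add: prehistory_def)
    qed
  qed
qed

lemma is_solution_solution: "is_solution L \<tau> \<phi> f (solution L \<tau> \<phi> f)"
  unfolding solution_def by (rule theI'[OF ex1_solution])

text \<open>A seminormed phase space is given by its carrier \<open>B\<close> and its seminorm \<open>p\<close>.\<close>

definition uniformly_stable ::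
  "(nat \<Rightarrow> ('a::real_normed_vector) hist \<Rightarrow> 'a) \<Rightarrow> 'a hist set \<Rightarrow> ('a hist \<Rightarrow> real) \<Rightarrow> bool" where
  "uniformly_stable L B p \<longleftrightarrow>
     (\<exists>K\<ge>1. \<forall>\<tau> n. \<tau> \<le> n \<longrightarrow> (\<forall>\<phi>\<in>B. norm (solution L \<tau> \<phi> (\<lambda>_. 0) (int n)) \<le> K * p \<phi>))"

definition ell_1_infinity_stable :: "(nat \<Rightarrow> ('a::real_normed_vector) hist \<Rightarrow> 'a) \<Rightarrow> bool" where
  "ell_1_infinity_stable L \<longleftrightarrow>
     (\<forall>f\<in>ell_1. (\<lambda>n::nat. solution L 0 (\<lambda>_. 0) f (int n)) \<in> ell_infinity)"

end

theory Submission
  imports Defs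
begin

text \<open>
  Let \<open>X(n, \<tau>)\<close> be the response at time \<open>n\<close> to a unit pulse in coordinate \<open>0\<close> at time \<open>\<tau>\<close>. By
  variation of constants, \<open>x(n, 0, 0; f)\<close> is the sum of \<open>X(n, m + 1) f(m)\<close> over \<open>m < n\<close>, so
  uniform stability gives stability with respect to summable inputs. Conversely, uniform
  boundedness turns the latter into a bound on \<open>X(n, \<tau>)\<close> for \<open>n \<ge> \<tau> \<ge> 1\<close>. Solving the recursion
  of \<open>X\<close> for the coefficients bounds all \<open>L(n, k)\<close>. A pulse in coordinate \<open>-k\<close> at time \<open>\<tau>\<close>
  becomes at time \<open>\<tau> + 1\<close> a pulse in coordinate \<open>-(k + 1)\<close> plus one in coordinate \<open>0\<close>, and it has
  no effect once \<open>k \<ge> d\<close>; descending from \<open>k = d\<close> therefore bounds the responses to all histories.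
\<close>

section \<open>Uniform boundedness for triangular kernels\<close>

text \<open>Otherwise \<open>max c 0 * norm T\<close> would be a nonnegative bound for
  \<open>T\<close> below its norm.\<close>

lemma blinfun_almost_attains_norm:
  fixes T :: "'a::real_normed_vector \<Rightarrow>\<^sub>L 'b::real_normed_vector"
  assumes "c < 1" "T \<noteq> 0"
  obtains x where "norm x = 1" "c * norm T < norm (blinfun_apply T x)"
proof -
  have "\<exists>x. max c 0 * norm T * norm x < norm (blinfun_apply T x)"
  proof (rule ccontr)
    assume "\<not> ?thesis"
    then have "norm T \<le> max c 0 * norm T"
      by (intro norm_blinfun_bound) (auto simp: not_less)
    with assms show False by (simp add: max_def split: if_splits)
  qed
  then obtain x where x: "max c 0 * norm T * norm x < norm (blinfun_apply T x)" ..
  then have nz: "x \<noteq> 0" by (auto simp: blinfun.zero_right)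
  show thesis
  proof (rule that)
    show "norm (x /\<^sub>R norm x) = 1" using nz by simp
    have "c * norm T \<le> max c 0 * norm T" by (intro mult_right_mono) auto
    also have "\<dots> < norm (blinfun_apply T x) / norm x"
      using x nz by (simp add: field_simps)
    finally show "c * norm T < norm (blinfun_apply T (x /\<^sub>R norm x))"
      by (simp add: blinfun.scaleR_right divide_inverse mult.commute)
  qed
qed

text \<open>Writes \<open>2 * b\<close> as a difference. It shows that one of two signs always
  avoids cancellation.\<close>

lemma norm_le_max_norm_add_diff:
  fixes a b :: "'a::real_normed_vector"
  shows "norm b \<le> max (norm (a + b)) (norm (a - b))"
proof -
  have "2 * norm b = norm ((a + b) - (a - b))"
    by (simp add: scaleR_2[symmetric])
  also have "\<dots> \<le> norm (a + b) + norm (a - b)" by (rule norm_triangle_ineq4)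
  finally show ?thesis by linarith
qed

text \<open>
  Uniform boundedness for triangular operators on summable sequences, by Sokal's argument: a
  summable \<open>f\<close> with unbounded image is the sum of pulses of norm \<open>3\<^sup>-\<^sup>i\<close>, each almost attaining the
  norm of an operator of norm at least \<open>12\<^sup>i\<close>, with signs chosen such that they do not cancel with
  their predecessors.
\<close>

lemma uniformly_bounded_kernel:
  fixes G :: "nat \<Rightarrow> nat \<Rightarrow> 'a::banach \<Rightarrow>\<^sub>L 'b::banach"
  assumes bdd: "\<And>f. f \<in> ell_1 \<Longrightarrow> bounded (range (\<lambda>n. \<Sum>m<n. blinfun_apply (G n m) (f m)))"
  shows "\<exists>K. \<forall>n. \<forall>m<n. norm (G n m) \<le> K"
proof (rule ccontr)
  assume "\<not> ?thesis"
  then have unb: "\<exists>n m. m < n \<and> K < norm (G n m)" for K by (auto simp: not_le)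
  define T where "T n f = (\<Sum>m<n. blinfun_apply (G n m) (f m))" for n f
  have T_add: "T n (\<lambda>m. f m + g m) = T n f + T n g"
    and T_diff: "T n (\<lambda>m. f m - g m) = T n f - T n g" for n f g
    by (simp_all add: T_def blinfun.add_right blinfun.diff_right sum.distrib sum_subtractf)
  \<comment> \<open>In a row with an entry above \<open>12 ^ i\<close>, the column of the largest
    entry is taken: the largest entry is the norm of the whole row on summable sequences.\<close>
  have "\<exists>n m \<psi>. m < n \<and> (\<forall>k<n. norm (G n k) \<le> norm (G n m)) \<and> 12 ^ i < norm (G n m) \<and>
      norm \<psi> = 1 \<and> 3 / 4 * norm (G n m) < norm (blinfun_apply (G n m) \<psi>)" for i
  proof -
    obtain n k where nk: "k < n" "12 ^ i < norm (G n k)" using unb by blast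
    obtain m where "m \<in> {..<n}" "norm (G n m) = (MAX k\<in>{..<n}. norm (G n k))"
      using obtains_MAX[of "{..<n}" "\<lambda>k. norm (G n k)"] nk(1) by (metis empty_iff finite_lessThan lessThan_iff)
    then have m: "m < n" "\<And>k. k < n \<Longrightarrow> norm (G n k) \<le> norm (G n m)" by auto
    have big: "12 ^ i < norm (G n m)" using nk m(2)[of k] by simp
    then have "G n m \<noteq> 0" by (auto simp: not_less)
    then obtain \<psi> where "norm \<psi> = 1" "3 / 4 * norm (G n m) < norm (blinfun_apply (G n m) \<psi>)"
      using blinfun_almost_attains_norm[of "3 / 4" "G n m"] by auto
    with m big show ?thesis by blast
  qed
  then obtain n m \<psi> where lt: "\<And>i. m i < n i"
    and mx: "\<And>i k. k < n i \<Longrightarrow> norm (G (n i) k) \<le> norm (G (n i) (m i))"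
    and big: "\<And>i. 12 ^ i < norm (G (n i) (m i))" and unit: "\<And>i. norm (\<psi> i) = 1"
    and att: "\<And>i. 3 / 4 * norm (G (n i) (m i)) < norm (blinfun_apply (G (n i) (m i)) (\<psi> i))"
    by metis
  define h where "h i k = (if k = m i then \<psi> i /\<^sub>R 3 ^ i else 0)" for i k
  have T_h: "T (n i) (h i) = blinfun_apply (G (n i) (m i)) (\<psi> i) /\<^sub>R 3 ^ i" for i
    using lt[of i] by (simp add: T_def h_def if_distrib sum.delta blinfun.scaleR_right
        blinfun.zero_right cong: if_cong)
  have "\<exists>F. F 0 = (\<lambda>_. 0) \<and> (\<forall>i. (F (Suc i) = (\<lambda>k. F i k + h i k) \<or> F (Suc i) = (\<lambda>k. F i k - h i k)) \<and>
      norm (T (n i) (h i)) \<le> norm (T (n i) (F (Suc i))))"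
  proof -
    \<comment> \<open>The sign of the \<open>i\<close>-th pulse is chosen by its effect on row
      \<open>n i\<close> together with all earlier pulses.\<close>
    define nxt where "nxt i g = (if norm (T (n i) (h i)) \<le> norm (T (n i) (\<lambda>k. g k + h i k))
      then (\<lambda>k. g k + h i k) else (\<lambda>k. g k - h i k))" for i g
    have "norm (T (n i) (h i)) \<le> norm (T (n i) (nxt i g))" for i g
      using norm_le_max_norm_add_diff[of "T (n i) (h i)" "T (n i) g"]
      by (simp add: nxt_def T_add T_diff max_def split: if_splits)
    moreover have "nxt i g = (\<lambda>k. g k + h i k) \<or> nxt i g = (\<lambda>k. g k - h i k)" for i g
      by (simp add: nxt_def)
    ultimately show ?thesis by (intro exI[of _ "rec_nat (\<lambda>_. 0) nxt"]) simp
  qed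
  then obtain F where F0: "F 0 = (\<lambda>_. 0)"
    and FS: "\<And>i. F (Suc i) = (\<lambda>k. F i k + h i k) \<or> F (Suc i) = (\<lambda>k. F i k - h i k)"
    and FT: "\<And>i. norm (T (n i) (h i)) \<le> norm (T (n i) (F (Suc i)))" by blast
  define e where "e i k = F (Suc i) k - F i k" for i k
  have e_norm: "norm (e i k) = (if k = m i then (1 / 3) ^ i else 0)" for i k
    using FS[of i] unit[of i] by (auto simp: e_def h_def power_one_over inverse_eq_divide)
  have geo: "(\<lambda>i. (1 / 3 :: real) ^ i) sums (3 / 2)"
    using geometric_sums[of "1 / 3 :: real"] by simp
  have summ_n: "summable (\<lambda>i. norm (e i k))" for k
    by (rule summable_comparison_test'[OF sums_summable[OF geo]]) (simp add: e_norm)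
  then have summ: "summable (\<lambda>i. e i k)" for k by (rule summable_norm_cancel)
  \<comment> \<open>The columns \<open>m i\<close> may repeat, so each coordinate of
    \<open>f\<close> is itself a series.\<close>
  define f where "f k = (\<Sum>i. e i k)" for k
  have f_sums: "(\<lambda>i. e i k) sums f k" for k using summ f_def by (simp add: summable_sums)
  have "f \<in> ell_1" unfolding ell_1_def
  proof (rule CollectI, rule summableI_nonneg_bounded)
    fix N
    have "(\<Sum>k<N. norm (f k)) \<le> (\<Sum>k<N. \<Sum>i. norm (e i k))"
      unfolding f_def by (intro sum_mono summable_norm summ_n)
    also have "\<dots> = (\<Sum>i. \<Sum>k<N. norm (e i k))"
      by (rule suminf_sum[symmetric]) (rule summ_n)
    also have "\<dots> \<le> (\<Sum>i. (1 / 3) ^ i)"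
    proof (rule suminf_le)
      show "summable (\<lambda>i. \<Sum>k<N. norm (e i k))" by (intro summable_sum summ_n)
    qed (use sums_summable[OF geo] in \<open>auto simp: e_norm sum.delta'\<close>)
    finally show "(\<Sum>k<N. norm (f k)) \<le> 3 / 2" using geo by (simp add: sums_iff)
  qed auto
  from bdd[OF this] obtain C where C: "\<And>n. norm (T n f) \<le> C"
    unfolding bounded_iff T_def by blast
  \<comment> \<open>With \<open>N\<close> the largest entry of row \<open>n i\<close>, the pulses up
    to \<open>i\<close> contribute at least \<open>3 / 4 * N * (1 / 3) ^ i\<close>, and the later
    ones at most \<open>N * (1 / 3) ^ i / 2\<close>. A quarter of \<open>N * (1 / 3) ^ i\<close>
    survives, and \<open>N\<close> exceeds \<open>12 ^ i\<close>.\<close>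
  have lower: "4 ^ i / 4 \<le> norm (T (n i) f)" for i
  proof -
    define N where "N = norm (G (n i) (m i))"
    have T_sums: "(\<lambda>j. T (n i) (e j)) sums T (n i) f"
      unfolding T_def by (intro sums_sum bounded_linear.sums[OF blinfun.bounded_linear_right] f_sums)
    have part: "(\<Sum>j<Suc i. T (n i) (e j)) = T (n i) (F (Suc i))"
    proof -
      have "(\<Sum>j<q. T (n i) (e j)) = T (n i) (F q)" for q
      proof (induction q)
        case 0
        then show ?case by (simp add: F0 T_def blinfun.zero_right)
      next
        case (Suc q)
        have "T (n i) (e q) = T (n i) (F (Suc q)) - T (n i) (F q)"
          by (simp add: T_diff[symmetric] e_def[abs_def])
        with Suc show ?case by simp
      qed
      then show ?thesis .
    qed
    have tail: "(\<lambda>j. T (n i) (e (j + Suc i))) sums (T (n i) f - T (n i) (F (Suc i)))"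
      using sums_split_initial_segment[OF T_sums, of "Suc i"] part by simp
    have T_e: "norm (T (n i) (e j)) \<le> N * (1 / 3) ^ j" for j
    proof -
      have "norm (T (n i) (e j)) \<le> (\<Sum>k<n i. N * norm (e j k))"
        unfolding T_def
      proof (rule sum_norm_le)
        fix k assume "k \<in> {..<n i}"
        then show "norm (blinfun_apply (G (n i) k) (e j k)) \<le> N * norm (e j k)"
          using norm_blinfun[of "G (n i) k" "e j k"] mx[of k i]
          by (metis N_def lessThan_iff mult_right_mono norm_ge_zero order_trans)
      qed
      also have "\<dots> \<le> N * (1 / 3) ^ j"
        by (simp add: sum_distrib_left[symmetric] e_norm sum.delta' N_def mult_left_mono)
      finally show ?thesis .
    qed
    have geo': "(\<lambda>j. N * (1 / 3) ^ (j + Suc i)) sums (N * (1 / 3) ^ i / 2)"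
      using sums_mult[OF geo, of "N * (1 / 3) ^ Suc i"] by (simp add: power_add mult_ac)
    have "norm (T (n i) f - T (n i) (F (Suc i))) \<le> N * (1 / 3) ^ i / 2"
      by (rule norm_sums_le[OF tail geo' T_e])
    moreover have "3 / 4 * N * (1 / 3) ^ i \<le> norm (T (n i) (F (Suc i)))"
      using FT[of i] att[of i] unfolding T_h N_def by (simp add: field_simps)
    moreover have "norm (T (n i) (F (Suc i))) \<le>
        norm (T (n i) f) + norm (T (n i) f - T (n i) (F (Suc i)))"
      by (metis norm_triangle_sub norm_minus_commute)
    moreover have "(4::real) ^ i \<le> N * (1 / 3) ^ i"
      using big[of i] by (simp add: N_def field_simps flip: power_mult_distrib)
    ultimately show ?thesis by linarith
  qed
  obtain i where "4 * C < 4 ^ i" using real_arch_pow[of 4 "4 * C"] by auto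
  with lower[of i] C[of "n i"] show False by linarith
qed

section \<open>Linearity and locality of the evolution of histories\<close>

locale delay_system =
  fixes L :: "nat \<Rightarrow> ('a::banach) hist \<Rightarrow> 'a" and d :: nat
  assumes delay: "bounded_delay L" and order: "d = delay_order L"
begin

abbreviation A :: "nat \<Rightarrow> nat \<Rightarrow> 'a \<Rightarrow> 'a" where
  "A \<equiv> coef L"

abbreviation evolve :: "nat \<Rightarrow> 'a hist \<Rightarrow> nat \<Rightarrow> 'a hist" where
  "evolve \<tau> \<phi> i \<equiv> hist_iter L \<tau> \<phi> (\<lambda>_. 0) i"

lemma L_eq: "L n \<phi> = (\<Sum>k<d. A n k (\<phi> k))"
  using delay by (simp add: bounded_delay_def order)

lemma bounded_linear_A: "bounded_linear (A n k)"
  using delay by (simp add: bounded_delay_def)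

lemmas A_0 [simp] = linear_0[OF bounded_linear.linear[OF bounded_linear_A]]

lemma L_sum: "L n (\<lambda>k. \<Sum>j\<in>I. \<phi> j k) = (\<Sum>j\<in>I. L n (\<phi> j))"
proof -
  have "L n (\<lambda>k. \<Sum>j\<in>I. \<phi> j k) = (\<Sum>k<d. \<Sum>j\<in>I. A n k (\<phi> j k))"
    by (subst L_eq) (simp only: linear_sum[OF bounded_linear.linear[OF bounded_linear_A]])
  then show ?thesis by (simp only: L_eq[of _ "\<phi> _"] sum.swap[of _ "{..<d}"])
qed

lemma L_add: "L n (\<lambda>k. \<phi> k + \<psi> k) = L n \<phi> + L n \<psi>"
proof -
  have "L n (\<lambda>k. \<phi> k + \<psi> k) = (\<Sum>k<d. A n k (\<phi> k) + A n k (\<psi> k))"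
    by (subst L_eq) (simp only: linear_add[OF bounded_linear.linear[OF bounded_linear_A]])
  then show ?thesis by (simp only: L_eq[of _ \<phi>] L_eq[of _ \<psi>] sum.distrib)
qed

lemma solution_eq_hist_iter: "solution L \<tau> \<phi> f (int (\<tau> + i)) = hist_iter L \<tau> \<phi> f i 0"
  using fun_cong[OF is_solution_prehistory[OF is_solution_solution, of L \<tau> \<phi> f i], of 0]
  by (simp add: prehistory_def)

lemma evolve_sum: "evolve \<tau> (\<lambda>k. \<Sum>j\<in>I. \<phi> j k) i = (\<lambda>k. \<Sum>j\<in>I. evolve \<tau> (\<phi> j) i k)"
proof (induction i)
  case (Suc i)
  show ?case unfolding hist_iter.simps Suc by (rule ext) (simp add: L_sum split: nat.split)
qed simp

lemma evolve_add: "evolve \<tau> (\<lambda>k. \<phi> k + \<psi> k) i = (\<lambda>k. evolve \<tau> \<phi> i k + evolve \<tau> \<psi> i k)"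
proof (induction i)
  case (Suc i)
  show ?case unfolding hist_iter.simps Suc by (rule ext) (simp add: L_add split: nat.split)
qed simp

text \<open>\<open>hist_iter\<close> splits off the last step. Splitting off the first one instead
  moves the starting time, as needed to rewrite a pulse at \<open>\<tau>\<close> by pulses at
  \<open>Suc \<tau>\<close>.\<close>

lemma evolve_Suc_shift: "evolve \<tau> \<phi> (Suc i) = evolve (Suc \<tau>) (case_nat (L \<tau> \<phi>) \<phi>) i"
  by (induction i) simp_all

text \<open>As \<open>d \<le> D\<close>, the first \<open>D\<close> coordinates evolve autonomously:
  the new coordinate 0 depends on those below \<open>d\<close> only, and the others are
  shifted.\<close>

lemma evolve_local:
  assumes "d \<le> D" "\<And>k. k < D \<Longrightarrow> \<phi> k = \<psi> k" "k < D"
  shows "evolve \<tau> \<phi> i k = evolve \<tau> \<psi> i k"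
  using assms(3)
proof (induction i arbitrary: k)
  case (Suc i)
  then have "L (\<tau> + i) (evolve \<tau> \<phi> i) = L (\<tau> + i) (evolve \<tau> \<psi> i)"
    using assms(1) by (subst (1 2) L_eq) (auto intro!: sum.cong)
  with Suc show ?case by (auto split: nat.split)
qed (use assms(2) in simp)

lemma bounded_linear_E_coord: "bounded_linear (\<lambda>\<psi>::'a. E_coord j \<psi> k)"
  by (cases "k = j") (simp_all add: E_coord_def)

text \<open>Makes the responses to pulses bounded operators, to which
  \<open>uniformly_bounded_kernel\<close> applies.\<close>

lemma bounded_linear_evolve: "bounded_linear (\<lambda>\<psi>. evolve \<tau> (E_coord j \<psi>) i k)"
proof (induction i arbitrary: k)
  case 0
  show ?case by (simp add: bounded_linear_E_coord)
next
  case (Suc i)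
  show ?case
  proof (cases k)
    case 0
    show ?thesis unfolding 0
      by (simp add: L_eq[of _ "evolve _ _ _"])
        (intro bounded_linear_sum bounded_linear_compose[OF bounded_linear_A] Suc)
  qed (simp add: Suc)
qed

section \<open>Pulse responses and stability for summable inputs\<close>

lemma variation_of_constants:
  "hist_iter L 0 (\<lambda>_. 0) f n = (\<lambda>k. \<Sum>m<n. evolve (Suc m) (E_coord 0 (f m)) (n - Suc m) k)"
proof (induction n)
  case (Suc n)
  \<comment> \<open>Each older pulse, \<open>m < n\<close>, makes one more step; the new pulse
    \<open>m = n\<close> has made none.\<close>
  have "evolve (Suc m) (E_coord 0 (f m)) (Suc n - Suc m) =
      case_nat (L n (evolve (Suc m) (E_coord 0 (f m)) (n - Suc m)))
        (evolve (Suc m) (E_coord 0 (f m)) (n - Suc m))" if "m < n" for m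
  proof -
    have "Suc n - Suc m = Suc (n - Suc m)" "Suc m + (n - Suc m) = n" using that by auto
    then show ?thesis by (simp only: hist_iter.simps add_0_right)
  qed
  then show ?case
    by (auto simp: fun_eq_iff Suc L_sum E_coord_def split: nat.split intro!: sum.cong)
qed simp

lemma response_to_input:
  "solution L 0 (\<lambda>_. 0) f (int n) = (\<Sum>m<n. evolve (Suc m) (E_coord 0 (f m)) (n - Suc m) 0)"
  using solution_eq_hist_iter[of 0 "\<lambda>_. 0" f n] by (simp add: variation_of_constants)

text \<open>The weight at coordinate 0 is 1, so the norm of such a pulse is the same for every
  \<open>\<gamma>\<close>.\<close>

lemma B_norm_E_coord_0:
  "E_coord 0 \<psi> \<in> B_space \<gamma>" "B_norm \<gamma> (E_coord 0 (\<psi>::'a)) = norm \<psi>"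
proof -
  have *: "norm (E_coord 0 \<psi> k) * exp (- \<gamma> * real k) = (if k = 0 then norm \<psi> else 0)" for k
    by (simp add: E_coord_def)
  show "E_coord 0 \<psi> \<in> B_space \<gamma>"
    unfolding B_space_def mem_Collect_eq * by (rule bdd_aboveI[of _ "norm \<psi>"]) auto
  show "B_norm \<gamma> (E_coord 0 \<psi>) = norm \<psi>"
    unfolding B_norm_def * by (rule cSup_eq_maximum) auto
qed

lemma uniformly_stable_imp_ell_1_infinity_stable:
  assumes "uniformly_stable L (B_space \<gamma>) (B_norm \<gamma>)"
  shows "ell_1_infinity_stable L"
proof -
  obtain K where K: "1 \<le> K" "\<And>\<tau> n \<phi>. \<tau> \<le> n \<Longrightarrow> \<phi> \<in> B_space \<gamma> \<Longrightarrow>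
      norm (solution L \<tau> \<phi> (\<lambda>_. 0) (int n)) \<le> K * B_norm \<gamma> \<phi>"
    using assms unfolding uniformly_stable_def by blast
  have pulse: "norm (evolve \<tau> (E_coord 0 \<psi>) i 0) \<le> K * norm \<psi>" for \<tau> i \<psi>
    using K(2)[of \<tau> "\<tau> + i" "E_coord 0 \<psi>"]
    by (simp add: B_norm_E_coord_0 solution_eq_hist_iter del: of_nat_add)
  show ?thesis
    unfolding ell_1_infinity_stable_def ell_1_def ell_infinity_def
  proof (intro ballI CollectI)
    fix f :: "nat \<Rightarrow> 'a"
    assume f: "f \<in> {f. summable (\<lambda>n. norm (f n))}"
    have "norm (solution L 0 (\<lambda>_. 0) f (int n)) \<le> K * (\<Sum>m. norm (f m))" for n
    proof -
      have "norm (solution L 0 (\<lambda>_. 0) f (int n)) \<le> (\<Sum>m<n. K * norm (f m))"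
        unfolding response_to_input by (intro sum_norm_le pulse)
      also have "\<dots> \<le> K * (\<Sum>m. norm (f m))"
        unfolding sum_distrib_left[symmetric] using f K(1)
        by (intro mult_left_mono sum_le_suminf) auto
      finally show ?thesis .
    qed
    then show "bounded (range (\<lambda>n. solution L 0 (\<lambda>_. 0) f (int n)))"
      unfolding bounded_iff by blast
  qed
qed

lemma uniformly_stable_window_imp_uniformly_stable:
  assumes "uniformly_stable L UNIV (B_window_norm \<gamma> J)"
  shows "uniformly_stable L (B_space \<gamma>) (B_norm \<gamma>)"
proof -
  obtain K where K: "1 \<le> K" "\<And>\<tau> n \<phi>. \<tau> \<le> n \<Longrightarrow>
      norm (solution L \<tau> \<phi> (\<lambda>_. 0) (int n)) \<le> K * B_window_norm \<gamma> J \<phi>"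
    using assms unfolding uniformly_stable_def by blast
  \<comment> \<open>A supremum over fewer coordinates; membership in \<open>B_space \<gamma>\<close>
    bounds the larger one.\<close>
  have "B_window_norm \<gamma> J \<phi> \<le> B_norm \<gamma> \<phi>" if "\<phi> \<in> B_space \<gamma>" for \<phi> :: "'a hist"
    using that unfolding B_window_norm_def B_norm_def B_space_def
    by (intro cSUP_subset_mono) auto
  then have "K * B_window_norm \<gamma> J \<phi> \<le> K * B_norm \<gamma> \<phi>" if "\<phi> \<in> B_space \<gamma>" for \<phi> :: "'a hist"
    using that K(1) by (intro mult_left_mono) auto
  with K show ?thesis unfolding uniformly_stable_def by (meson order_trans)
qed

text \<open>Inputs at time \<open>m\<close> act as pulses at time \<open>m + 1\<close>, so pulses at time \<open>0\<close> are not covered.\<close>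

lemma ell_1_infinity_stable_imp_pulse_bound:
  assumes "ell_1_infinity_stable L"
  obtains K where "0 \<le> K" "\<And>\<tau> i \<psi>. norm (evolve (Suc \<tau>) (E_coord 0 \<psi>) i 0) \<le> K * norm \<psi>"
proof -
  \<comment> \<open>For \<open>m < n\<close> this is \<open>X(n, m + 1)\<close>:
    \<open>n - Suc m\<close> steps lead from time \<open>m + 1\<close> to time
    \<open>n\<close>.\<close>
  define G where "G n m = Blinfun (\<lambda>\<psi>. evolve (Suc m) (E_coord 0 \<psi>) (n - Suc m) 0)" for n m
  have G: "blinfun_apply (G n m) \<psi> = evolve (Suc m) (E_coord 0 \<psi>) (n - Suc m) 0" for n m \<psi>
    unfolding G_def by (simp add: bounded_linear_Blinfun_apply[OF bounded_linear_evolve])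
  have "\<exists>K. \<forall>n. \<forall>m<n. norm (G n m) \<le> K"
    by (rule uniformly_bounded_kernel)
      (use assms in \<open>simp add: G response_to_input[symmetric] ell_1_infinity_stable_def ell_infinity_def\<close>)
  then obtain K where K: "\<And>n m. m < n \<Longrightarrow> norm (G n m) \<le> K" by blast
  show thesis
  proof (rule that)
    show "0 \<le> K" using order_trans[OF norm_ge_zero K[of 0 1]] by simp
    show "norm (evolve (Suc \<tau>) (E_coord 0 \<psi>) i 0) \<le> K * norm \<psi>" for \<tau> i \<psi>
      using norm_blinfun[of "G (Suc \<tau> + i) \<tau>" \<psi>] K[of \<tau> "Suc \<tau> + i"]
      by (simp add: G) (meson mult_right_mono norm_ge_zero order_trans)
  qed
qed

section \<open>Bounds on coefficients, lagged pulses and general histories\<close>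

text \<open>After \<open>k\<close> steps the pulse stands in coordinate \<open>k\<close>, so the
  next value contains \<open>A n k \<psi>\<close> plus terms with coefficients of lower index, which
  strong induction bounds.\<close>

lemma pulse_bound_imp_coef_bound:
  assumes "0 \<le> K" and pulse: "\<And>\<tau> i \<psi>. norm (evolve (Suc \<tau>) (E_coord 0 \<psi>) i 0) \<le> K * norm \<psi>"
  shows "k < d \<Longrightarrow> \<exists>M. 0 \<le> M \<and> (\<forall>n \<psi>. norm (A n k \<psi>) \<le> M * norm \<psi>)"
proof (induction k rule: less_induct)
  case (less k)
  then have "\<forall>j\<in>{..<k}. \<exists>M. 0 \<le> M \<and> (\<forall>n \<psi>. norm (A n j \<psi>) \<le> M * norm \<psi>)" by auto
  then obtain M where M: "\<And>j. j < k \<Longrightarrow> 0 \<le> M j"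
      "\<And>j n \<psi>. j < k \<Longrightarrow> norm (A n j \<psi>) \<le> M j * norm \<psi>"
    by (metis lessThan_iff)
  \<comment> \<open>Pulses start at time 1 or later and reach coordinate \<open>k\<close> only at
    times \<open>n > k\<close>, where \<open>M1\<close> is the bound. \<open>M2\<close> covers the
    finitely many \<open>n \<le> k\<close>.\<close>
  define M1 where "M1 = K + (\<Sum>j<k. M j * K)"
  define M2 where "M2 = (\<Sum>n\<le>k. onorm (A n k))"
  have M1: "0 \<le> M1" unfolding M1_def using assms(1) M(1) by (intro add_nonneg_nonneg sum_nonneg) auto
  have M2: "0 \<le> M2" unfolding M2_def by (intro sum_nonneg onorm_pos_le bounded_linear_A)
  have late: "norm (A (Suc \<tau> + k) k \<psi>) \<le> M1 * norm \<psi>" for \<tau> \<psi>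
  proof -
    define h where "h = evolve (Suc \<tau>) (E_coord 0 \<psi>)"
    have h: "h k j = (if j \<le> k then h (k - j) 0 else 0)" for j
      unfolding h_def by (subst hist_iter_shift) (simp add: E_coord_def)
    have "h (Suc k) 0 = (\<Sum>j<d. A (Suc \<tau> + k) j (h k j))"
      by (simp add: h_def L_eq)
    \<comment> \<open>Before the pulse the history is zero, so coordinates beyond \<open>k\<close>
      vanish.\<close>
    also have "\<dots> = (\<Sum>j<Suc k. A (Suc \<tau> + k) j (h k j))"
      using less.prems by (intro sum.mono_neutral_right) (auto simp: h)
    also have "\<dots> = (\<Sum>j<k. A (Suc \<tau> + k) j (h (k - j) 0)) + A (Suc \<tau> + k) k \<psi>"
    proof -
      have "h 0 0 = \<psi>" by (simp add: h_def E_coord_def)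
      then show ?thesis by (simp add: h)
    qed
    finally have "A (Suc \<tau> + k) k \<psi> = h (Suc k) 0 - (\<Sum>j<k. A (Suc \<tau> + k) j (h (k - j) 0))"
      by (simp add: algebra_simps)
    also have "norm \<dots> \<le> K * norm \<psi> + (\<Sum>j<k. M j * (K * norm \<psi>))"
    proof (intro order_trans[OF norm_triangle_ineq4] add_mono sum_norm_le)
      show "norm (h (Suc k) 0) \<le> K * norm \<psi>" unfolding h_def by (rule pulse)
      fix j assume "j \<in> {..<k}"
      then have j: "j < k" by simp
      have "norm (h (k - j) 0) \<le> K * norm \<psi>" unfolding h_def by (rule pulse)
      with M[OF j] show "norm (A (Suc \<tau> + k) j (h (k - j) 0)) \<le> M j * (K * norm \<psi>)"
        by (meson mult_left_mono order_trans)
    qed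
    also have "\<dots> = M1 * norm \<psi>"
      by (simp add: M1_def distrib_right sum_distrib_right mult.assoc)
    finally show ?thesis .
  qed
  have "norm (A n k \<psi>) \<le> (M1 + M2) * norm \<psi>" for n \<psi>
  proof (cases "n \<le> k")
    case True
    have "norm (A n k \<psi>) \<le> onorm (A n k) * norm \<psi>" by (rule onorm[OF bounded_linear_A])
    also have "onorm (A n k) \<le> M2"
      unfolding M2_def using True by (intro member_le_sum onorm_pos_le bounded_linear_A) auto
    finally show ?thesis using M1 M2 by (simp add: distrib_right add_increasing mult_right_mono)
  next
    case False
    then obtain \<tau> where "n = Suc \<tau> + k" by (metis add.commute less_imp_Suc_add not_le add_Suc)
    then have "norm (A n k \<psi>) \<le> M1 * norm \<psi>" using late by simp
    then show ?thesis using M2 by (simp add: distrib_right add_increasing2)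
  qed
  then show ?case using M1 M2 by (intro exI[of _ "M1 + M2"]) simp
qed

text \<open>Coordinates below \<open>d\<close> stay zero, hence so does every new value. The initial
  coordinate 0 is \<open>\<psi>\<close> if \<open>k = 0\<close>, which can occur for
  \<open>d = 0\<close>.\<close>

lemma pulse_beyond_delay:
  assumes "d \<le> k"
  shows "norm (evolve \<tau> (E_coord k \<psi>) i 0) \<le> norm \<psi>"
proof (cases i)
  case (Suc q)
  have "evolve \<tau> (E_coord k \<psi>) q j = 0" if "j < d" for j
    \<comment> \<open>The empty-sum case of \<open>evolve_sum\<close> says that the zero history
      stays zero.\<close>
    using evolve_local[of d "E_coord k \<psi>" "\<lambda>_. 0" j \<tau> q] evolve_sum[of \<tau> "\<lambda>_ _. 0" "{}" q]
      assms that by (simp add: E_coord_def)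
  then show ?thesis by (simp add: Suc L_eq)
qed (simp add: E_coord_def)

text \<open>Here \<open>\<tau> = 0\<close> is included: the new pulse in coordinate 0 arises at time
  \<open>Suc \<tau>\<close>, where the assumed bound applies.\<close>

lemma lagged_pulse_bound:
  assumes "0 \<le> K" and pulse: "\<And>\<tau> i \<psi>. norm (evolve (Suc \<tau>) (E_coord 0 \<psi>) i 0) \<le> K * norm \<psi>"
  shows "\<exists>W\<ge>0. \<forall>\<tau> i \<psi>. norm (evolve \<tau> (E_coord k \<psi>) i 0) \<le> W * norm \<psi>"
proof (cases "d \<le> k")
  case True
  then show ?thesis using pulse_beyond_delay by (intro exI[of _ 1]) simp
next
  case False
  then have "k \<le> d" by simp
  then show ?thesis
  proof (induction k rule: inc_induct)
    case base
    show ?case using pulse_beyond_delay by (intro exI[of _ 1]) simp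
  next
    case (step k)
    obtain W where W: "0 \<le> W" "\<And>\<tau> i \<psi>. norm (evolve \<tau> (E_coord (Suc k) \<psi>) i 0) \<le> W * norm \<psi>"
      using step.IH by blast
    obtain M where M: "0 \<le> M" "\<And>n \<psi>. norm (A n k \<psi>) \<le> M * norm \<psi>"
      using pulse_bound_imp_coef_bound[OF assms \<open>k < d\<close>] by blast
    \<comment> \<open>The summand 1 covers step 0, \<open>W\<close> the lagged pulse, and
      \<open>K * M\<close> the new pulse \<open>A \<tau> k \<psi>\<close>.\<close>
    have "norm (evolve \<tau> (E_coord k \<psi>) i 0) \<le> (1 + W + K * M) * norm \<psi>" for \<tau> i \<psi>
    proof (cases i)
      case 0
      have "0 \<le> (W + K * M) * norm \<psi>" using W(1) M(1) assms(1) by simp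
      then show ?thesis by (simp add: 0 E_coord_def algebra_simps)
    next
      case (Suc q)
      have "case_nat (L \<tau> (E_coord k \<psi>)) (E_coord k \<psi>) =
          (\<lambda>j. E_coord (Suc k) \<psi> j + E_coord 0 (A \<tau> k \<psi>) j)"
        by (auto simp: fun_eq_iff E_coord_def coef_def split: nat.split)
      then have "evolve \<tau> (E_coord k \<psi>) i 0 =
          evolve (Suc \<tau>) (E_coord (Suc k) \<psi>) q 0 + evolve (Suc \<tau>) (E_coord 0 (A \<tau> k \<psi>)) q 0"
        unfolding Suc evolve_Suc_shift by (simp add: evolve_add)
      also have "norm \<dots> \<le> W * norm \<psi> + K * norm (A \<tau> k \<psi>)"
        by (intro order_trans[OF norm_triangle_ineq] add_mono W pulse)
      also have "\<dots> \<le> norm \<psi> + W * norm \<psi> + K * (M * norm \<psi>)"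
        using mult_left_mono[OF M(2) assms(1), of \<tau> \<psi>] norm_ge_zero[of \<psi>] by linarith
      finally show ?thesis by (simp add: algebra_simps)
    qed
    then show ?case using W(1) M(1) assms(1) by (intro exI[of _ "1 + W + K * M"]) auto
  qed
qed

text \<open>By locality a history may be replaced by the finite sum of the pulses in its window, and
  their responses are added up.\<close>

lemma ell_1_infinity_stable_imp_uniformly_stable_window:
  assumes "ell_1_infinity_stable L" "d \<le> Suc J"
  shows "uniformly_stable L UNIV (B_window_norm \<gamma> J)"
proof -
  obtain K where "0 \<le> K" "\<And>\<tau> i \<psi>. norm (evolve (Suc \<tau>) (E_coord 0 \<psi>) i 0) \<le> K * norm \<psi>"
    using ell_1_infinity_stable_imp_pulse_bound[OF assms(1)] by blast
  then have "\<forall>k. \<exists>W\<ge>0. \<forall>\<tau> i \<psi>. norm (evolve \<tau> (E_coord k \<psi>) i 0) \<le> W * norm \<psi>"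
    using lagged_pulse_bound by blast
  then obtain W where W: "\<And>k. 0 \<le> W k"
      "\<And>k \<tau> i \<psi>. norm (evolve \<tau> (E_coord k \<psi>) i 0) \<le> W k * norm \<psi>" by metis
  \<comment> \<open>The factor \<open>exp (\<gamma> * real k)\<close> undoes the weight in the
    seminorm. Below, \<open>1 + C\<close> replaces \<open>C\<close> because the stability constant
    must be at least 1.\<close>
  define C where "C = (\<Sum>k<Suc J. W k * exp (\<gamma> * real k))"
  have C: "0 \<le> C" unfolding C_def using W(1) by (intro sum_nonneg mult_nonneg_nonneg) auto
  have "norm (solution L \<tau> \<phi> (\<lambda>_. 0) (int n)) \<le> (1 + C) * B_window_norm \<gamma> J \<phi>"
    if "\<tau> \<le> n" for \<tau> n \<phi>
  proof -
    obtain i where n: "n = \<tau> + i" using \<open>\<tau> \<le> n\<close> le_Suc_ex by blast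
    have window: "norm (\<phi> k) * exp (- \<gamma> * real k) \<le> B_window_norm \<gamma> J \<phi>" if "k \<le> J" for k
      unfolding B_window_norm_def using that by (intro cSUP_upper) auto
    have coord: "norm (\<phi> k) \<le> exp (\<gamma> * real k) * B_window_norm \<gamma> J \<phi>" if "k \<le> J" for k
      using window[OF that] by (simp add: exp_minus field_simps)
    have "evolve \<tau> \<phi> i 0 = evolve \<tau> (\<lambda>j. \<Sum>k<Suc J. E_coord k (\<phi> k) j) i 0"
    proof (rule evolve_local[OF assms(2)])
      show "\<phi> j = (\<Sum>k<Suc J. E_coord k (\<phi> k) j)" if "j < Suc J" for j
        unfolding E_coord_def using that by (subst sum.delta') auto
    qed simp
    then have "solution L \<tau> \<phi> (\<lambda>_. 0) (int n) = (\<Sum>k<Suc J. evolve \<tau> (E_coord k (\<phi> k)) i 0)"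
      unfolding n solution_eq_hist_iter evolve_sum .
    also have "norm \<dots> \<le> (\<Sum>k<Suc J. W k * exp (\<gamma> * real k) * B_window_norm \<gamma> J \<phi>)"
    proof (rule sum_norm_le)
      fix k assume "k \<in> {..<Suc J}"
      then have "norm (\<phi> k) \<le> exp (\<gamma> * real k) * B_window_norm \<gamma> J \<phi>" by (intro coord) simp
      from mult_left_mono[OF this W(1)] W(2)
      show "norm (evolve \<tau> (E_coord k (\<phi> k)) i 0) \<le> W k * exp (\<gamma> * real k) * B_window_norm \<gamma> J \<phi>"
        by (simp add: mult.assoc) (meson order_trans)
    qed
    also have "\<dots> = C * B_window_norm \<gamma> J \<phi>" by (simp only: C_def sum_distrib_right)
    also have "\<dots> \<le> (1 + C) * B_window_norm \<gamma> J \<phi>"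
      using coord[of 0] by (intro mult_right_mono) (auto intro: order_trans[OF norm_ge_zero])
    finally show ?thesis .
  qed
  with C show ?thesis unfolding uniformly_stable_def by (intro exI[of _ "1 + C"]) auto
qed

end

theorem corollary4p7:
  fixes \<gamma> :: real
    and L :: "nat \<Rightarrow> (nat \<Rightarrow> 'a::banach) \<Rightarrow> 'a"
    and d :: nat
  assumes "bounded_delay L"
    and "d = delay_order L"
  shows "(uniformly_stable L (B_space \<gamma>) (B_norm \<gamma>) \<longleftrightarrow> ell_1_infinity_stable L) \<and>
    (d \<ge> 1 \<longrightarrow>
      (uniformly_stable L (B_space \<gamma>) (B_norm \<gamma>) \<longleftrightarrow>
       uniformly_stable L UNIV (B_window_norm \<gamma> (d - 1))))"
proof -
  interpret delay_system L d
    using assms by unfold_locales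
  \<comment> \<open>This closes a cycle of three implications. For \<open>d = 0\<close> the window
    length \<open>d - 1\<close> is 0, and \<open>d \<le> Suc (d - 1)\<close> still holds.\<close>
  have "ell_1_infinity_stable L \<Longrightarrow> uniformly_stable L UNIV (B_window_norm \<gamma> (d - 1))"
    by (rule ell_1_infinity_stable_imp_uniformly_stable_window) simp_all
  then show ?thesis
    using uniformly_stable_imp_ell_1_infinity_stable uniformly_stable_window_imp_uniformly_stable
    by blast
qed

end
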